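(* Let $R$ be a finite local commutative ring with identity. Then the unit-zero divisor graph $G_{UZ}(R)$ is a planar graph if and only if $|U(R)|\leq 2$ or $|Z(R)|\leq 2$.
   Context: For a finite commutative ring $R$ with identity, $U(R)$ is the set of units and $Z(R)$ is the set of zero divisors, with the convention $0\in Z(R)$. The unit-zero divisor graph $G_{UZ}(R)$ is the simple undirected graph whose vertex set is the set of all elements of $R$, where two distinct vertices $u,v$ are adjacent if and only if $u+v\in U(R)$ and $uv\in Z(R)$. A commutative ring with identity is local if it has a unique maximal ideal. By Kuratowski's theorem, a finite graph is planar if and only if it has no subgraph that is a subdivision of $K_5$ or $K_{3,3}$. *)

theory Defs
  imports "HOL-Analysis.Analysis" "HOL-Algebra.Ideal"
begin

definition local_ring :: "('a, 'b) ring_scheme \<Rightarrow> bool"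
  where "local_ring R \<longleftrightarrow> cring R \<and> (\<exists>!M. maximalideal M R)"

definition zero_divisors :: "('a, 'b) ring_scheme \<Rightarrow> 'a set"
  where "zero_divisors R =
    insert \<zero>\<^bsub>R\<^esub> {a \<in> carrier R. \<exists>b \<in> carrier R. b \<noteq> \<zero>\<^bsub>R\<^esub> \<and> a \<otimes>\<^bsub>R\<^esub> b = \<zero>\<^bsub>R\<^esub>}"

text \<open>A simple undirected graph is a pair \<open>(V, E)\<close> of a vertex set and a set of
  two-element subsets of \<open>V\<close>.\<close>

type_synonym 'v ugraph = "'v set \<times> 'v set set"

definition unit_zero_divisor_graph :: "('a, 'b) ring_scheme \<Rightarrow> 'a ugraph"
  where "unit_zero_divisor_graph R =
    (carrier R,
     {{u, v} | u v. u \<in> carrier R \<and> v \<in> carrier R \<and> u \<noteq> v \<and>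
        u \<oplus>\<^bsub>R\<^esub> v \<in> Units R \<and> u \<otimes>\<^bsub>R\<^esub> v \<in> zero_divisors R})"

text \<open>A drawing in the plane \<open>complex\<close> sends vertices to distinct points and each edge to an
  arc joining the points of its two ends; the interior of such an arc contains no vertex point
  and meets no arc of another edge.\<close>

definition plane_drawing :: "'v ugraph \<Rightarrow> ('v \<Rightarrow> complex) \<Rightarrow> ('v set \<Rightarrow> real \<Rightarrow> complex) \<Rightarrow> bool"
  where "plane_drawing G p \<gamma> \<longleftrightarrow>
    inj_on p (fst G) \<and>
    (\<forall>e \<in> snd G.
       arc (\<gamma> e) \<and> {pathstart (\<gamma> e), pathfinish (\<gamma> e)} = p ` e \<and>
       (path_image (\<gamma> e) - p ` e) \<inter> p ` fst G = {} \<and>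
       (\<forall>f \<in> snd G. f \<noteq> e \<longrightarrow> (path_image (\<gamma> e) - p ` e) \<inter> path_image (\<gamma> f) = {}))"

definition planar_graph :: "'v ugraph \<Rightarrow> bool"
  where "planar_graph G \<longleftrightarrow> (\<exists>p \<gamma>. plane_drawing G p \<gamma>)"

end

(* In a finite local ring the zero divisors are the nonunits and form an ideal, so two elements
   are adjacent iff exactly one of them is a unit: the graph is complete bipartite, with parts
   Z(R) and U(R).  If one part has at most two vertices, put these at -1 and 1 and the others on
   the imaginary axis.  Otherwise the graph contains K_{3,3}, which is shown directly to have no
   plane drawing, by the Jordan curve theorem and Janiszewski's theorem. *)
theory Submission
  imports Defs
begin

section \<open>Theta curves\<close>

text \<open>By the Jordan curve theorem the inside and the outside are open, connected, cover the
  complement and both have the whole curve as frontier. The connected set \<open>T\<close> lies in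
  one of them, and \<open>D\<close> is the other.\<close>

lemma simple_closed_curve_other_side:
  fixes c :: "real \<Rightarrow> complex"
  assumes c: "simple_path c" "pathfinish c = pathstart c"
    and T: "connected T" "T \<inter> path_image c = {}"
  obtains D where "connected D" "D \<noteq> {}" "path_image c \<subseteq> closure D" "D \<inter> path_image c = {}"
    "D \<inter> T = {}"
    "\<And>x y. \<lbrakk>x \<in> T; y \<in> D\<rbrakk> \<Longrightarrow> \<not> connected_component (- path_image c) x y"
proof -
  let ?I = "inside (path_image c)" and ?O = "outside (path_image c)"
  note J = Jordan_inside_outside[OF c]
  \<comment> \<open>Two disjoint open sets cover \<open>S\<close>, so a connected \<open>S\<close>
    cannot meet both.\<close>
  have sides: "S \<inter> ?I = {} \<or> S \<inter> ?O = {}" if "connected S" "S \<inter> path_image c = {}" for S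
  proof -
    have "open ?I" "open ?O" "S \<subseteq> ?I \<union> ?O" "?I \<inter> ?O \<inter> S = {}"
      using J that by auto
    with \<open>connected S\<close> show ?thesis
      using connectedD[of S ?I ?O] by (auto simp: Int_commute)
  qed
  have sep: "\<not> connected_component (- path_image c) x y"
    if "x \<in> ?I \<and> y \<in> ?O \<or> x \<in> ?O \<and> y \<in> ?I" for x y
  proof
    assume "connected_component (- path_image c) x y"
    then obtain S where "connected S" "S \<subseteq> - path_image c" "x \<in> S" "y \<in> S"
      by (auto simp: connected_component_def)
    then show False
      using sides[of S] that by blast
  qed
  have "frontier ?I = path_image c" "frontier ?O = path_image c" "?I \<union> ?O = - path_image c"
    using J by simp_all
  then have IO: "path_image c \<subseteq> closure ?I" "path_image c \<subseteq> closure ?O" "?I \<union> ?O = - path_image c"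
    by (simp_all add: closure_Un_frontier)
  consider "T \<inter> ?I = {}" | "T \<inter> ?O = {}"
    using sides[OF T] by blast
  then show thesis
  proof cases
    case 1
    show ?thesis
    proof (rule that)
      show "connected ?I" "?I \<noteq> {}" "path_image c \<subseteq> closure ?I"
        using J IO by simp_all
      show "?I \<inter> path_image c = {}" "?I \<inter> T = {}"
        using IO(3) 1 by blast+
      show "\<not> connected_component (- path_image c) x y" if "x \<in> T" "y \<in> ?I" for x y
        using that sep 1 IO(3) T(2) by blast
    qed
  next
    case 2
    show ?thesis
    proof (rule that)
      show "connected ?O" "?O \<noteq> {}" "path_image c \<subseteq> closure ?O"
        using J IO by simp_all
      show "?O \<inter> path_image c = {}" "?O \<inter> T = {}"
        using IO(3) 2 by blast+
      show "\<not> connected_component (- path_image c) x y" if "x \<in> T" "y \<in> ?O" for x y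
        using that sep 2 IO(3) T(2) by blast
    qed
  qed
qed

text \<open>
  Let \<open>D\<close> be the side of the closed curve \<open>c1 \<union> c2\<close> not containing \<open>C\<close> and \<open>c3\<close>.  A point
  of \<open>D\<close> is linked to \<open>C\<close> through \<open>c1\<close> in the complement of \<open>c2 \<union> c3\<close>, and through \<open>c2\<close> in
  the complement of \<open>c1 \<union> c3\<close>; as these two sets meet in the connected set \<open>c3\<close>,
  Janiszewski's theorem links it to \<open>C\<close> in the complement of \<open>c1 \<union> c2\<close>.
\<close>

lemma theta_no_common_face:
  fixes a b :: complex
  assumes c1: "arc c1" "pathstart c1 = a" "pathfinish c1 = b"
    and c2: "arc c2" "pathstart c2 = a" "pathfinish c2 = b"
    and c3: "arc c3" "pathstart c3 = a" "pathfinish c3 = b"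
    and c12: "path_image c1 \<inter> path_image c2 \<subseteq> {a, b}"
    and c13: "path_image c1 \<inter> path_image c3 \<subseteq> {a, b}"
    and c23: "path_image c2 \<inter> path_image c3 \<subseteq> {a, b}"
    and C: "connected C" "C \<inter> (path_image c1 \<union> path_image c2 \<union> path_image c3) = {}"
    and p1: "p1 \<in> closure C \<inter> path_image c1 - {a, b}"
    and p2: "p2 \<in> closure C \<inter> path_image c2 - {a, b}"
    and p3: "p3 \<in> closure C \<inter> path_image c3 - {a, b}"
  shows False
proof -
  have ends: "a \<in> path_image c1" "b \<in> path_image c1" "a \<in> path_image c2" "b \<in> path_image c2"
    "a \<in> path_image c3" "b \<in> path_image c3"
    using c1 c2 c3 pathstart_in_path_image pathfinish_in_path_image by metis+
  have open_arc: "connected (path_image c - {a, b})"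
    if "arc c" "pathstart c = a" "pathfinish c = b" for c
    using connected_simple_path_endless[OF arc_imp_simple_path[OF that(1)]] that by simp
  \<comment> \<open>A single point of \<open>closure C\<close> on the open arc suffices: adding it
    keeps \<open>C\<close> connected, and it is then common to both sets.\<close>
  have attach: "connected (C \<union> (path_image c - {a, b}))"
    if "arc c" "pathstart c = a" "pathfinish c = b" "p \<in> closure C \<inter> path_image c - {a, b}" for c p
  proof -
    have "connected (insert p C)"
      using that(4) closure_subset[of C] by (intro connected_intermediate_closure[OF C(1)]) auto
    then have "connected (insert p C \<union> (path_image c - {a, b}))"
      using open_arc[OF that(1-3)] that(4) by (intro connected_Un) auto
    moreover have "insert p C \<union> (path_image c - {a, b}) = C \<union> (path_image c - {a, b})"
      using that(4) by auto
    ultimately show ?thesis by simp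
  qed
  have "simple_path (c1 +++ reversepath c2)"
    using c1 c2 c12 by (intro simple_path_join_loop) (auto simp: arc_reversepath)
  moreover have im: "path_image (c1 +++ reversepath c2) = path_image c1 \<union> path_image c2"
    using c1 c2 by (simp add: path_image_join)
  moreover have "pathfinish (c1 +++ reversepath c2) = pathstart (c1 +++ reversepath c2)"
    using c1 c2 by simp
  \<comment> \<open>The open arc of \<open>c3\<close> is counted to the side of \<open>C\<close>, so
    that \<open>D\<close> avoids \<open>c3\<close> as well.\<close>
  moreover have "(C \<union> (path_image c3 - {a, b})) \<inter> path_image (c1 +++ reversepath c2) = {}"
    unfolding im using C(2) c13 c23 by blast
  ultimately obtain D where D: "connected D" "D \<noteq> {}" "path_image c1 \<union> path_image c2 \<subseteq> closure D"
    "D \<inter> (path_image c1 \<union> path_image c2) = {}" "D \<inter> (C \<union> (path_image c3 - {a, b})) = {}"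
    "\<And>x y. \<lbrakk>x \<in> C \<union> (path_image c3 - {a, b}); y \<in> D\<rbrakk>
      \<Longrightarrow> \<not> connected_component (- (path_image c1 \<union> path_image c2)) x y"
    using simple_closed_curve_other_side[of "c1 +++ reversepath c2" "C \<union> (path_image c3 - {a, b})"]
      attach[OF c3 p3] unfolding im by metis
  have "C \<noteq> {}"
    using p1 by auto
  then obtain x y where xy: "x \<in> C" "y \<in> D"
    using D(2) by auto
  \<comment> \<open>Stated for a pair \<open>c\<close>, \<open>d\<close>, to be used with
    \<open>c1\<close>, \<open>c2\<close> in both orders. Since \<open>p\<close> lies in
    \<open>closure D\<close> and on the open arc of \<open>c\<close>, it bridges \<open>D\<close>
    and \<open>C\<close> along \<open>c\<close>.\<close>
  have link: "connected_component (- (path_image d \<union> path_image c3)) x y"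
    if c: "arc c" "pathstart c = a" "pathfinish c = b" "p \<in> closure C \<inter> path_image c - {a, b}"
      and "path_image c \<subseteq> closure D" "path_image c \<inter> path_image d \<subseteq> {a, b}"
      "path_image c \<inter> path_image c3 \<subseteq> {a, b}" "D \<inter> path_image d = {}" "C \<inter> path_image d = {}"
      "a \<in> path_image d" "b \<in> path_image d"
    for c d p
    unfolding connected_component_def
  proof (intro exI conjI)
    have "connected (insert p D)"
      using that(4,5) closure_subset[of D] by (intro connected_intermediate_closure[OF D(1)]) auto
    then show "connected (insert p D \<union> (C \<union> (path_image c - {a, b})))"
      using that(4) by (intro connected_Un attach[OF c]) auto
    show "insert p D \<union> (C \<union> (path_image c - {a, b})) \<subseteq> - (path_image d \<union> path_image c3)"
      using that D(5) C(2) D(4) ends c13 by blast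
  qed (use xy in auto)
  have "connected_component (- ((path_image c2 \<union> path_image c3) \<union> (path_image c1 \<union> path_image c3))) x y"
  proof (rule Janiszewski)
    show "compact (path_image c2 \<union> path_image c3)" "closed (path_image c1 \<union> path_image c3)"
      using c1 c2 c3 by (auto simp: compact_arc_image closed_arc_image compact_Un closed_Un)
    \<comment> \<open>Points common to \<open>c1\<close> and \<open>c2\<close> are among
      \<open>a\<close> and \<open>b\<close>, which lie on \<open>c3\<close> anyway.\<close>
    have "(path_image c2 \<union> path_image c3) \<inter> (path_image c1 \<union> path_image c3) = path_image c3"
      using c12 ends by blast
    then show "connected ((path_image c2 \<union> path_image c3) \<inter> (path_image c1 \<union> path_image c3))"
      using c3 by (simp add: connected_arc_image)
    show "connected_component (- (path_image c2 \<union> path_image c3)) x y"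
      by (rule link[OF c1 p1]) (use D(3,4) C(2) c12 c13 ends in blast)+
    show "connected_component (- (path_image c1 \<union> path_image c3)) x y"
      by (rule link[OF c2 p2]) (use D(3,4) C(2) c12 c23 ends in blast)+
  qed
  then have "connected_component (- (path_image c1 \<union> path_image c2)) x y"
    by (rule connected_component_of_subset) auto
  then show False
    using D(6) xy by auto
qed

section \<open>Planarity of complete bipartite graphs\<close>

text \<open>Edges are unordered, so the arc of a drawing may run either way; reversing it if
  necessary gives the orientation that joining paths requires.\<close>

lemma plane_drawing_edge_arc:
  assumes "plane_drawing G p \<gamma>" "{u, v} \<in> snd G"
  obtains g where "arc g" "pathstart g = p u" "pathfinish g = p v" "path_image g = path_image (\<gamma> {u, v})"
proof -
  have "arc (\<gamma> {u, v})" "{pathstart (\<gamma> {u, v}), pathfinish (\<gamma> {u, v})} = {p u, p v}"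
    using assms by (auto simp: plane_drawing_def)
  then consider "pathstart (\<gamma> {u, v}) = p u" "pathfinish (\<gamma> {u, v}) = p v"
    | "pathstart (\<gamma> {u, v}) = p v" "pathfinish (\<gamma> {u, v}) = p u"
    by (metis doubleton_eq_iff)
  then show thesis
  proof cases
    case 1
    then show ?thesis using that \<open>arc (\<gamma> {u, v})\<close> by blast
  next
    case 2
    then show ?thesis using that[of "reversepath (\<gamma> {u, v})"] \<open>arc (\<gamma> {u, v})\<close>
      by (simp add: arc_reversepath)
  qed
qed

text \<open>The interior of each arc avoids the other arc, so only images of ends of both edges
  remain; injectivity of \<open>p\<close> makes these images of common ends.\<close>

lemma plane_drawing_edges_Int:
  assumes G: "plane_drawing G p \<gamma>" and ef: "e \<in> snd G" "f \<in> snd G" "e \<noteq> f"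
    and V: "e \<subseteq> fst G" "f \<subseteq> fst G"
  shows "path_image (\<gamma> e) \<inter> path_image (\<gamma> f) \<subseteq> p ` (e \<inter> f)"
proof -
  have "(path_image (\<gamma> e) - p ` e) \<inter> path_image (\<gamma> f) = {}"
    "(path_image (\<gamma> f) - p ` f) \<inter> path_image (\<gamma> e) = {}"
    using G ef unfolding plane_drawing_def by blast+
  then have "path_image (\<gamma> e) \<inter> path_image (\<gamma> f) \<subseteq> p ` e \<inter> p ` f"
    by blast
  also have "\<dots> = p ` (e \<inter> f)"
    using G V inj_on_image_Int[of p "fst G" e f] by (simp add: plane_drawing_def)
  finally show ?thesis .
qed

text \<open>The arc without its final point is the image of \<open>{0..<1}\<close>, a connected set
  with 1 in its closure.\<close>

lemma arc_delete_finish: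
  fixes g :: "real \<Rightarrow> complex"
  assumes "arc g"
  shows "connected (path_image g - {pathfinish g})" "pathfinish g \<in> closure (path_image g - {pathfinish g})"
proof -
  have inj: "inj_on g {0..1}" and cont: "continuous_on {0..1} g"
    using assms by (auto simp: arc_def path_def)
  have eq: "path_image g - {pathfinish g} = g ` {0..<1}"
  proof -
    have "{0..1} - {1} = {0..<1::real}" by auto
    then show ?thesis
      using inj_on_image_set_diff[OF inj, of "{0..1}" "{1}"] by (auto simp: path_image_def pathfinish_def)
  qed
  show "connected (path_image g - {pathfinish g})"
    unfolding eq by (intro connected_continuous_image continuous_on_subset[OF cont]) auto
  have "g ` closure {0..<1} \<subseteq> closure (g ` {0..<1})"
    by (rule continuous_image_closure_subset[OF cont]) simp
  then show "pathfinish g \<in> closure (path_image g - {pathfinish g})"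
    unfolding eq by (auto simp: pathfinish_def)
qed

text \<open>
  The edges at \<open>a1\<close> and \<open>a2\<close> form a theta curve, and the edges at \<open>a3\<close> without their far
  ends form a connected set whose closure meets all three of its arcs.
\<close>

lemma K33_not_planar:
  assumes E: "\<And>a b. \<lbrakk>a \<in> {a1, a2, a3}; b \<in> {b1, b2, b3}\<rbrakk> \<Longrightarrow> {a, b} \<in> snd G"
    and V: "{a1, a2, a3, b1, b2, b3} \<subseteq> fst G"
    and dist: "distinct [a1, a2, a3, b1, b2, b3]"
  shows "\<not> planar_graph G"
proof
  assume "planar_graph G"
  then obtain p \<gamma> where G: "plane_drawing G p \<gamma>"
    by (auto simp: planar_graph_def)
  define A where "A = {a1, a2, a3}"
  define B where "B = {b1, b2, b3}"
  define is_edge_arc where "is_edge_arc a b g \<longleftrightarrow> arc g \<and> pathstart g = p a \<and> pathfinish g = p b \<and>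
    path_image g = path_image (\<gamma> {a, b})" for a b g
  define g where "g a b = (SOME g. is_edge_arc a b g)" for a b
  have "is_edge_arc a b (g a b)" if "a \<in> A" "b \<in> B" for a b
    unfolding g_def
  proof (rule someI_ex[of "is_edge_arc a b"])
    show "\<exists>g. is_edge_arc a b g"
      using plane_drawing_edge_arc[OF G E[of a b]] that unfolding A_def B_def is_edge_arc_def by metis
  qed
  then have g: "\<And>a b. \<lbrakk>a \<in> A; b \<in> B\<rbrakk> \<Longrightarrow> arc (g a b)"
    "\<And>a b. \<lbrakk>a \<in> A; b \<in> B\<rbrakk> \<Longrightarrow> pathstart (g a b) = p a"
    "\<And>a b. \<lbrakk>a \<in> A; b \<in> B\<rbrakk> \<Longrightarrow> pathfinish (g a b) = p b"
    "\<And>a b. \<lbrakk>a \<in> A; b \<in> B\<rbrakk> \<Longrightarrow> path_image (g a b) = path_image (\<gamma> {a, b})"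
    by (auto simp: is_edge_arc_def)
  have AB: "A \<inter> B = {}" "A \<subseteq> fst G" "B \<subseteq> fst G"
    using dist V by (auto simp: A_def B_def)
  have pinj: "p u = p v \<longleftrightarrow> u = v" if "u \<in> A \<union> B" "v \<in> A \<union> B" for u v
    using G AB that unfolding plane_drawing_def by (meson Un_least inj_on_eq_iff subsetD)
  have meet: "path_image (g a b) \<inter> path_image (g a' b') \<subseteq> p ` ({a, b} \<inter> {a', b'})"
    if "a \<in> A" "b \<in> B" "a' \<in> A" "b' \<in> B" "(a, b) \<noteq> (a', b')" for a b a' b'
  proof -
    have "{a, b} \<noteq> {a', b'}"
      using that AB by (auto simp: doubleton_eq_iff)
    moreover have "{a, b} \<in> snd G" "{a', b'} \<in> snd G"
      using E that unfolding A_def B_def by blast+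
    moreover have "{a, b} \<subseteq> fst G" "{a', b'} \<subseteq> fst G"
      using that AB by auto
    ultimately show ?thesis
      using plane_drawing_edges_Int[OF G, of "{a, b}" "{a', b'}"] that by (simp add: g(4))
  qed
  \<comment> \<open>The path from \<open>a1\<close> through \<open>b\<close> to \<open>a2\<close>;
    its three instances form the theta curve with ends \<open>p a1\<close> and
    \<open>p a2\<close>.\<close>
  define c where "c b = g a1 b +++ reversepath (g a2 b)" for b
  have aA: "a1 \<in> A" "a2 \<in> A" "a3 \<in> A" "a1 \<noteq> a2" "a1 \<noteq> a3" "a2 \<noteq> a3"
    using dist by (auto simp: A_def)
  have bB: "b1 \<in> B" "b2 \<in> B" "b3 \<in> B" "b1 \<noteq> b2" "b1 \<noteq> b3" "b2 \<noteq> b3"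
    using dist by (auto simp: B_def)
  have im: "path_image (c b) = path_image (g a1 b) \<union> path_image (g a2 b)" if "b \<in> B" for b
    using that aA g by (simp add: c_def path_image_join)
  have c: "arc (c b)" "pathstart (c b) = p a1" "pathfinish (c b) = p a2" if "b \<in> B" for b
  proof -
    have "path_image (g a1 b) \<inter> path_image (g a2 b) \<subseteq> {p b}"
      using meet[of a1 b a2 b] that aA AB by auto
    then show "arc (c b)"
      unfolding c_def using that aA g by (intro arc_join) (auto simp: arc_reversepath)
  qed (use that aA g in \<open>auto simp: c_def\<close>)
  have cc: "path_image (c b) \<inter> path_image (c b') \<subseteq> {p a1, p a2}"
    if "b \<in> B" "b' \<in> B" "b \<noteq> b'" for b b'
  proof -
    have "path_image (g a b) \<inter> path_image (g a' b') \<subseteq> {p a1, p a2}"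
      if "a \<in> {a1, a2}" "a' \<in> {a1, a2}" for a a'
    proof -
      have "a \<in> A" "a' \<in> A" using that aA by auto
      \<comment> \<open>As \<open>b\<close> and \<open>b'\<close> differ, a common end of the two
        edges lies in \<open>A\<close>.\<close>
      moreover have "{a, b} \<inter> {a', b'} \<subseteq> {a1, a2}"
        using that \<open>b \<in> B\<close> \<open>b' \<in> B\<close> \<open>b \<noteq> b'\<close> AB(1) calculation by auto
      ultimately show ?thesis
        using meet[of a b a' b'] \<open>b \<in> B\<close> \<open>b' \<in> B\<close> \<open>b \<noteq> b'\<close> by blast
    qed
    then show ?thesis
      unfolding im[OF that(1)] im[OF that(2)] by (simp add: Int_Un_distrib Int_Un_distrib2)
  qed
  define C where "C = (\<Union>b\<in>B. path_image (g a3 b) - {p b})"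
  have "connected C"
    unfolding C_def
  proof (rule connected_Union)
    fix S assume "S \<in> (\<lambda>b. path_image (g a3 b) - {p b}) ` B"
    then obtain b where "b \<in> B" "S = path_image (g a3 b) - {p b}" by blast
    then show "connected S"
      using arc_delete_finish(1)[OF g(1)[OF aA(3)], of b] g(3)[OF aA(3)] by simp
  next
    \<comment> \<open>The centre \<open>p a3\<close> of the star lies in all three pieces and holds
      them together.\<close>
    have "p a3 \<in> path_image (g a3 b) - {p b}" if "b \<in> B" for b
    proof -
      have "p a3 \<noteq> p b" using pinj[of a3 b] that aA AB by auto
      then show ?thesis
        using g(2)[of a3 b] that aA by (metis DiffI pathstart_in_path_image singletonD)
    qed
    then show "\<Inter> ((\<lambda>b. path_image (g a3 b) - {p b}) ` B) \<noteq> {}"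
      by blast
  qed
  have clos: "p b \<in> closure C \<inter> path_image (c b) - {p a1, p a2}" if "b \<in> B" for b
  proof -
    have "p b \<in> closure (path_image (g a3 b) - {p b})"
      using arc_delete_finish(2)[of "g a3 b"] g that aA by simp
    then have "p b \<in> closure C"
      using that closure_mono[of "path_image (g a3 b) - {p b}" C] by (auto simp: C_def)
    moreover have "p b \<in> path_image (c b)"
      using im[OF that] g(3)[of a1 b] that aA by (metis UnI1 pathfinish_in_path_image)
    moreover have "p b \<noteq> p a1" "p b \<noteq> p a2"
      using pinj that aA AB by auto
    ultimately show ?thesis by simp
  qed
  have disj: "C \<inter> path_image (c b) = {}" if "b \<in> B" for b
  proof -
    \<comment> \<open>An edge at \<open>a3\<close> can meet one at \<open>a1\<close> or
      \<open>a2\<close> only in the far end \<open>p b'\<close>, which has been removed.\<close>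
    have "(path_image (g a3 b') - {p b'}) \<inter> path_image (g a b) = {}" if "b' \<in> B" "a \<in> {a1, a2}" for a b'
    proof -
      have "a \<in> A" "a \<noteq> a3" using that aA by auto
      moreover have "{a3, b'} \<inter> {a, b} \<subseteq> {b'}"
        using that calculation \<open>b \<in> B\<close> aA AB(1) by auto
      ultimately show ?thesis
        using meet[of a3 b' a b] \<open>b \<in> B\<close> aA that by blast
    qed
    then show ?thesis
      unfolding im[OF that] C_def by blast
  qed
  show False
    using theta_no_common_face[OF c[OF bB(1)] c[OF bB(2)] c[OF bB(3)] cc cc cc \<open>connected C\<close> _
        clos[OF bB(1)] clos[OF bB(2)] clos[OF bB(3)]] disj bB
    by (simp add: Int_Un_distrib)
qed

text \<open>Straight segments serve as edges. An interior point of a segment from 1 or -1 to the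
  imaginary axis determines it: the sign of the real part gives the end in \<open>A\<close>, its
  absolute value the parameter, and the imaginary part then the end in \<open>B\<close>.\<close>

lemma complete_bipartite_planar:
  assumes A: "finite A" "card A \<le> 2" and B: "finite B" and AB: "A \<inter> B = {}"
  shows "planar_graph (A \<union> B, {{a, b} | a b. a \<in> A \<and> b \<in> B})"
proof -
  obtain f :: "'a \<Rightarrow> nat" where f: "f ` A = {..<card A}" "inj_on f A"
    using ex_bij_betw_finite_nat[OF A(1)] by (auto simp: bij_betw_def atLeast0LessThan)
  obtain h :: "'a \<Rightarrow> nat" where h: "inj_on h B"
    using ex_bij_betw_finite_nat[OF B] by (auto simp: bij_betw_def)
  \<comment> \<open>The values 0 and 1 of \<open>f\<close> go to -1 and 1. A vertex of
    \<open>B\<close> may sit at the origin, since no edge joins -1 to 1.\<close>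
  define p where "p v = (if v \<in> A then Complex (2 * real (f v) - 1) 0 else Complex 0 (real (h v)))" for v
  \<comment> \<open>An edge has exactly one end in each part, so both descriptions are well defined
    and the segment runs from \<open>A\<close> to \<open>B\<close>.\<close>
  define \<gamma> where "\<gamma> e = linepath (p (THE a. a \<in> A \<inter> e)) (p (THE b. b \<in> B \<inter> e))" for e
  have pA: "Re (p a) = 1 \<or> Re (p a) = - 1" "Im (p a) = 0" if "a \<in> A" for a
  proof -
    have "f a < card A" using f(1) that by blast
    then have "f a < 2" using A(2) by simp
    then show "Re (p a) = 1 \<or> Re (p a) = - 1" "Im (p a) = 0"
      using that by (auto simp: p_def less_2_cases_iff)
  qed
  have pB: "Re (p b) = 0" if "b \<in> B" for b
    using that AB by (auto simp: p_def)
  have inj: "inj_on p (A \<union> B)"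
  proof (rule inj_onI)
    fix u v assume uv: "u \<in> A \<union> B" "v \<in> A \<union> B" and eq: "p u = p v"
    have "u \<in> A \<longleftrightarrow> v \<in> A"
    proof -
      have "w \<in> A \<longleftrightarrow> Re (p w) \<noteq> 0" if "w \<in> A \<union> B" for w
        using that pA(1)[of w] pB[of w] AB by auto
      then show ?thesis using uv eq by metis
    qed
    moreover have "u = v" if "u \<in> A" "v \<in> A"
      using that eq inj_onD[OF f(2), of u v] by (simp add: p_def)
    moreover have "u = v" if "u \<notin> A" "v \<notin> A"
      using that uv eq inj_onD[OF h, of u v] by (simp add: p_def)
    ultimately show "u = v" by blast
  qed
  have edge: "\<gamma> {a, b} = linepath (p a) (p b)" if "a \<in> A" "b \<in> B" for a b
  proof -
    have "A \<inter> {a, b} = {a}" "B \<inter> {a, b} = {b}" using that AB by auto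
    then show ?thesis by (simp add: \<gamma>_def)
  qed
  have pt: "\<exists>t. 0 < t \<and> t < 1 \<and> Re z = (1 - t) * Re (p a) \<and> Im z = t * Im (p b)"
    if ab: "a \<in> A" "b \<in> B" and z: "z \<in> path_image (\<gamma> {a, b}) - {p a, p b}" for a b z
  proof -
    obtain t where t: "0 \<le> t" "t \<le> 1" "z = (1 - t) *\<^sub>R p a + t *\<^sub>R p b"
      using z edge[OF ab] by (auto simp: closed_segment_def)
    moreover have "t \<noteq> 0" "t \<noteq> 1"
      using t(3) z by auto
    moreover have "Re z = (1 - t) * Re (p a)" "Im z = t * Im (p b)"
      using t(3) pA(2)[OF ab(1)] pB[OF ab(2)] by simp_all
    ultimately show ?thesis
      by (intro exI[of _ t]) simp
  qed
  have off_vertices: "z \<notin> p ` (A \<union> B)"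
    if ab: "a \<in> A" "b \<in> B" and z: "z \<in> path_image (\<gamma> {a, b}) - {p a, p b}" for a b z
  proof
    assume "z \<in> p ` (A \<union> B)"
    \<comment> \<open>Interior points of a segment have real part strictly between 0 and 1 in
      absolute value.\<close>
    then have "Re z \<in> {0, 1, - 1}"
      using pA(1) pB by fastforce
    then show False
      using pt[OF that] pA(1)[OF ab(1)] by auto
  qed
  have disjoint: "False"
    if ab: "a \<in> A" "b \<in> B" "a' \<in> A" "b' \<in> B" "{a', b'} \<noteq> {a, b}"
      and z: "z \<in> path_image (\<gamma> {a, b}) - {p a, p b}" "z \<in> path_image (\<gamma> {a', b'})" for a b a' b' z
  proof -
    \<comment> \<open>Being no vertex point, \<open>z\<close> is interior to the second segment too,
      so both parametrizations apply.\<close>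
    have z': "z \<in> path_image (\<gamma> {a', b'}) - {p a', p b'}"
      using off_vertices[OF ab(1,2) z(1)] z(2) ab by auto
    obtain t where t: "0 < t" "t < 1" "Re z = (1 - t) * Re (p a)" "Im z = t * Im (p b)"
      using pt[OF ab(1,2) z(1)] by auto
    obtain t' where t': "0 < t'" "t' < 1" "Re z = (1 - t') * Re (p a')" "Im z = t' * Im (p b')"
      using pt[OF ab(3,4) z'] by auto
    have "Re (p a) = Re (p a')" "t = t'"
      using t(1-3) t'(1-3) pA(1)[OF ab(1)] pA(1)[OF ab(3)] by auto
    then have "p a = p a'" "p b = p b'"
      using t t' pA pB ab by (auto simp: complex_eq_iff)
    then have "a = a'" "b = b'"
      using inj ab by (auto dest: inj_onD)
    then show False using ab by simp
  qed
  have arcs: "arc (\<gamma> {a, b})" "pathstart (\<gamma> {a, b}) = p a" "pathfinish (\<gamma> {a, b}) = p b"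
    if "a \<in> A" "b \<in> B" for a b
  proof -
    have "p a \<noteq> p b" using pA(1) pB that by fastforce
    then show "arc (\<gamma> {a, b})" "pathstart (\<gamma> {a, b}) = p a" "pathfinish (\<gamma> {a, b}) = p b"
      by (simp_all add: edge that)
  qed
  have "plane_drawing (A \<union> B, {{a, b} | a b. a \<in> A \<and> b \<in> B}) p \<gamma>"
    unfolding plane_drawing_def fst_conv snd_conv
  proof (intro conjI ballI impI)
    show "inj_on p (A \<union> B)" by (rule inj)
  next
    fix e assume "e \<in> {{a, b} | a b. a \<in> A \<and> b \<in> B}"
    then obtain a b where e: "e = {a, b}" and ab: "a \<in> A" "b \<in> B" by auto
    show "arc (\<gamma> e)" "{pathstart (\<gamma> e), pathfinish (\<gamma> e)} = p ` e"
      using arcs[OF ab] by (auto simp: e)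
    show "(path_image (\<gamma> e) - p ` e) \<inter> p ` (A \<union> B) = {}"
      using off_vertices[OF ab] by (auto simp: e)
    fix f assume "f \<in> {{a, b} | a b. a \<in> A \<and> b \<in> B}" "f \<noteq> e"
    then obtain a' b' where f: "f = {a', b'}" "a' \<in> A" "b' \<in> B" "{a', b'} \<noteq> {a, b}"
      using e by auto
    show "(path_image (\<gamma> e) - p ` e) \<inter> path_image (\<gamma> f) = {}"
      using disjoint[OF ab f(2-4)] by (auto simp: e f(1))
  qed
  then show ?thesis
    by (auto simp: planar_graph_def)
qed

text \<open>Three vertices from each part span a K_{3,3}; \<open>K33_not_planar\<close> only asks
  for its nine edges to be present, so it applies to the whole graph. Conversely, the roles of the
  parts can be exchanged to put the small one first.\<close>

lemma complete_bipartite_planar_iff: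
  assumes A: "finite A" and B: "finite B" and AB: "A \<inter> B = {}"
  shows "planar_graph (A \<union> B, {{a, b} | a b. a \<in> A \<and> b \<in> B}) \<longleftrightarrow> card A \<le> 2 \<or> card B \<le> 2"
    (is "planar_graph ?G \<longleftrightarrow> _")
proof
  assume planar: "planar_graph ?G"
  show "card A \<le> 2 \<or> card B \<le> 2"
  proof (rule ccontr)
    assume "\<not> (card A \<le> 2 \<or> card B \<le> 2)"
    then have "3 \<le> card A" "3 \<le> card B" by auto
    then obtain S T where "S \<subseteq> A" "card S = 3" "T \<subseteq> B" "card T = 3"
      by (meson obtain_subset_with_card_n)
    then obtain a1 a2 a3 b1 b2 b3 where S: "S = {a1, a2, a3}" "distinct [a1, a2, a3]" "S \<subseteq> A"
      and T: "T = {b1, b2, b3}" "distinct [b1, b2, b3]" "T \<subseteq> B"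
      by (auto simp: card_3_iff)
    have "\<not> planar_graph ?G"
      by (rule K33_not_planar[of a1 a2 a3 b1 b2 b3]) (use S T AB in auto)
    then show False using planar by simp
  qed
next
  assume "card A \<le> 2 \<or> card B \<le> 2"
  moreover have "?G = (B \<union> A, {{b, a} | b a. b \<in> B \<and> a \<in> A})"
    by (auto simp: insert_commute)
  ultimately show "planar_graph ?G"
    using complete_bipartite_planar[OF A _ B AB] complete_bipartite_planar[OF B _ A] AB
    by (metis inf_commute)
qed

section \<open>Finite local rings\<close>

text \<open>A unit can be cancelled from \<open>a \<otimes> b = \<zero>\<close>. Conversely,
  multiplication by a nonunit misses 1, so on a finite carrier it is not injective either, and the
  difference of two elements with equal image is annihilated.\<close>

lemma (in cring) zero_divisors_eq_nonunits:
  assumes "finite (carrier R)" "\<one> \<noteq> \<zero>"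
  shows "zero_divisors R = carrier R - Units R"
proof (intro subset_antisym subsetI)
  fix a assume a: "a \<in> zero_divisors R"
  \<comment> \<open>The inserted element 0 is annihilated by the nonzero element 1, so it needs no
    separate case.\<close>
  have "\<exists>b \<in> carrier R. b \<noteq> \<zero> \<and> \<zero> \<otimes> b = \<zero>"
    by (rule bexI[of _ \<one>]) (use assms(2) in auto)
  then have "\<exists>b \<in> carrier R. b \<noteq> \<zero> \<and> a \<otimes> b = \<zero>" "a \<in> carrier R"
    using a by (auto simp: zero_divisors_def)
  then obtain b where ab: "a \<in> carrier R" "b \<in> carrier R" "b \<noteq> \<zero>" "a \<otimes> b = \<zero>"
    by auto
  have "a \<notin> Units R"
  proof
    assume "a \<in> Units R"
    have "b = (inv a \<otimes> a) \<otimes> b"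
      using ab \<open>a \<in> Units R\<close> by simp
    also have "\<dots> = inv a \<otimes> (a \<otimes> b)"
      using ab \<open>a \<in> Units R\<close> by (intro m_assoc) auto
    finally show False using ab \<open>a \<in> Units R\<close> by simp
  qed
  then show "a \<in> carrier R - Units R" using ab by simp
next
  fix a assume a: "a \<in> carrier R - Units R"
  have "\<one> \<notin> (\<lambda>x. a \<otimes> x) ` carrier R"
  proof
    assume "\<one> \<in> (\<lambda>x. a \<otimes> x) ` carrier R"
    then obtain x where "x \<in> carrier R" "a \<otimes> x = \<one>" by auto
    then show False using a m_comm[of a x] by (auto simp: Units_def)
  qed
  then have "(\<lambda>x. a \<otimes> x) ` carrier R \<noteq> carrier R"
    by auto
  then have "\<not> inj_on (\<lambda>x. a \<otimes> x) (carrier R)"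
    using a endo_inj_surj[OF assms(1), of "\<lambda>x. a \<otimes> x"] by auto
  then obtain x y where xy: "x \<in> carrier R" "y \<in> carrier R" "x \<noteq> y" "a \<otimes> x = a \<otimes> y"
    by (auto simp: inj_on_def)
  have "a \<otimes> (x \<ominus> y) = \<zero>"
    using a xy by (simp add: minus_eq r_distr r_minus r_neg)
  moreover have "x \<ominus> y \<noteq> \<zero>"
    using xy minus_equality[of x "\<ominus> y"] by (auto simp: minus_eq)
  ultimately show "a \<in> zero_divisors R"
    using a xy by (auto simp: zero_divisors_def)
qed

text \<open>Finiteness replaces Zorn's lemma: the proper ideals containing \<open>a\<close> form a
  finite family, nonempty because the principal ideal of a nonunit misses 1.\<close>

lemma (in cring) ex_maximalideal_of_nonunit:
  assumes "finite (carrier R)" "a \<in> carrier R - Units R"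
  shows "\<exists>M. maximalideal M R \<and> a \<in> M"
proof -
  define \<I> where "\<I> = {I. ideal I R \<and> a \<in> I \<and> I \<noteq> carrier R}"
  have sub: "I \<subseteq> carrier R" if "ideal I R" for I
    using ideal.Icarr[OF that] by (rule subsetI)
  have "\<one> \<notin> PIdl a"
  proof
    assume "\<one> \<in> PIdl a"
    then obtain x where "x \<in> carrier R" "x \<otimes> a = \<one>" by (auto simp: cgenideal_def)
    then show False using assms(2) m_comm[of a x] by (auto simp: Units_def)
  qed
  then have "PIdl a \<in> \<I>"
    using assms(2) by (auto simp: \<I>_def cgenideal_ideal cgenideal_self)
  moreover have "finite \<I>"
    using assms(1) sub by (intro finite_subset[of \<I> "Pow (carrier R)"]) (auto simp: \<I>_def)
  ultimately obtain M where M: "M \<in> \<I>" "\<And>J. \<lbrakk>J \<in> \<I>; M \<subseteq> J\<rbrakk> \<Longrightarrow> J = M"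
    using finite_has_maximal2 by metis
  have "maximalideal M R"
    by (rule maximalidealI) (use M in \<open>auto simp: \<I>_def\<close>)
  then show ?thesis using M(1) by (auto simp: \<I>_def)
qed

text \<open>A maximal ideal is proper and so contains no unit, while every nonunit lies in some
  maximal ideal, hence in the only one.\<close>

lemma (in cring) local_ring_nonunits_maximalideal:
  assumes "finite (carrier R)" "local_ring R"
  shows "maximalideal (carrier R - Units R) R"
proof -
  obtain M where M: "maximalideal M R" "\<And>N. maximalideal N R \<Longrightarrow> N = M"
    using assms(2) by (auto simp: local_ring_def)
  interpret maximalideal M R by (rule M(1))
  have "M \<inter> Units R = {}"
  proof -
    have "u \<notin> M" if "u \<in> Units R" for u
    proof
      assume "u \<in> M"
      then have "inv u \<otimes> u \<in> M" using that by (intro I_l_closed) auto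
      then show False using that one_imp_carrier I_notcarr by simp
    qed
    then show ?thesis by auto
  qed
  moreover have "carrier R - Units R \<subseteq> M"
    using ex_maximalideal_of_nonunit[OF assms(1)] M(2) by blast
  ultimately have "carrier R - Units R = M"
    using a_subset by blast
  then show ?thesis using M(1) by simp
qed

lemma (in cring) local_ring_zero_divisors:
  assumes "finite (carrier R)" "local_ring R"
  shows "zero_divisors R = carrier R - Units R"
proof -
  interpret M: maximalideal "carrier R - Units R" R
    by (rule local_ring_nonunits_maximalideal[OF assms])
  \<comment> \<open>0 lies in the ideal of nonunits and 1 does not, which excludes the zero
    ring.\<close>
  have "\<one> \<noteq> \<zero>"
    using M.zero_closed Units_one_closed by (metis DiffD2)
  then show ?thesis
    by (rule zero_divisors_eq_nonunits[OF assms(1)])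
qed

text \<open>Because the nonunits form an ideal, a unit and a nonunit have a unit as sum and a
  nonunit as product. Two units fail the product condition, two nonunits the sum condition.\<close>

lemma (in cring) unit_zero_divisor_graph_local:
  assumes "finite (carrier R)" "local_ring R"
  shows "unit_zero_divisor_graph R =
    (zero_divisors R \<union> Units R, {{a, b} | a b. a \<in> zero_divisors R \<and> b \<in> Units R})"
proof -
  interpret M: maximalideal "carrier R - Units R" R
    by (rule local_ring_nonunits_maximalideal[OF assms])
  have Z: "zero_divisors R = carrier R - Units R"
    by (rule local_ring_zero_divisors[OF assms])
  have prod: "u \<otimes> v \<in> Units R" if "u \<in> Units R" "v \<in> Units R" for u v
    using that by simp
  have adj: "(u \<oplus> v \<in> Units R \<and> u \<otimes> v \<notin> Units R) \<longleftrightarrow>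
      (u \<in> Units R \<longleftrightarrow> v \<notin> Units R)" if uv: "u \<in> carrier R" "v \<in> carrier R" for u v
  proof -
    have 1: "v \<in> carrier R - Units R \<Longrightarrow> u \<oplus> v \<in> Units R" if "u \<in> Units R" "v \<in> carrier R" for u v
    proof (rule ccontr)
      assume v: "v \<in> carrier R - Units R" and "u \<oplus> v \<notin> Units R"
      then have "u \<oplus> v \<in> carrier R - Units R" using that Units_closed by simp
      \<comment> \<open>Subtracting \<open>v\<close> inside the ideal would make the unit
        \<open>u\<close> a nonunit.\<close>
      then have "(u \<oplus> v) \<oplus> \<ominus> v \<in> carrier R - Units R"
        using M.a_inv_closed[OF v] by (rule M.a_closed)
      moreover have "(u \<oplus> v) \<oplus> \<ominus> v = u"
        using that Units_closed[of u] by (simp add: a_assoc r_neg)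
      ultimately show False using that by simp
    qed
    have 2: "u \<otimes> v \<notin> Units R" if "u \<in> Units R" "v \<in> carrier R - Units R" for u v
      using M.I_l_closed[of v u] that by auto
    have 3: "u \<oplus> v \<notin> Units R" if "u \<notin> Units R" "v \<notin> Units R"
      using M.a_closed[of u v] that uv by auto
    show ?thesis
      using 1[of u v] 1[of v u] 2[of u v] 2[of v u] 3 uv prod[of u v] a_comm[OF uv] m_comm[OF uv] by auto
  qed
  \<comment> \<open>The condition \<open>u \<noteq> v\<close> is absorbed, since exactly one of the
    two is a unit.\<close>
  have "{{u, v} | u v. u \<in> carrier R \<and> v \<in> carrier R \<and> u \<noteq> v \<and>
      u \<oplus> v \<in> Units R \<and> u \<otimes> v \<in> zero_divisors R} =
    {{u, v} | u v. u \<in> carrier R \<and> v \<in> carrier R \<and> (u \<in> Units R \<longleftrightarrow> v \<notin> Units R)}"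
    (is "?E = _")
    using adj unfolding Z by blast
  also have "\<dots> = {{a, b} | a b. a \<in> carrier R - Units R \<and> b \<in> Units R}" (is "?L = ?R")
  proof
    show "?L \<subseteq> ?R"
    proof
      fix e assume "e \<in> ?L"
      then obtain u v where "e = {u, v}" "u \<in> carrier R" "v \<in> carrier R"
        "u \<in> Units R \<longleftrightarrow> v \<notin> Units R" by auto
      then show "e \<in> ?R"
        by (cases "u \<in> Units R") (auto simp: insert_commute)
    qed
    show "?R \<subseteq> ?L" using Units_closed by blast
  qed
  finally show ?thesis
    using Units_closed by (auto simp: unit_zero_divisor_graph_def Z)
qed

theorem theorem3p10:
  fixes R :: "('a, 'b) ring_scheme"
  assumes "local_ring R" and "finite (carrier R)"
  shows "planar_graph (unit_zero_divisor_graph R) \<longleftrightarrow>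
    card (Units R) \<le> 2 \<or> card (zero_divisors R) \<le> 2"
proof -
  interpret cring R
    using assms(1) by (simp add: local_ring_def)
  have Z: "zero_divisors R = carrier R - Units R"
    by (rule local_ring_zero_divisors[OF assms(2,1)])
  \<comment> \<open>Finiteness of both parts ensures that \<open>card\<close> is their true size and
    not the default 0.\<close>
  have "finite (zero_divisors R)" "finite (Units R)" "zero_divisors R \<inter> Units R = {}"
    using assms(2) Units_closed finite_subset[of "Units R" "carrier R"] by (auto simp: Z)
  then show ?thesis
    unfolding unit_zero_divisor_graph_local[OF assms(2,1)]
    by (subst complete_bipartite_planar_iff) auto
qed

end
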